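(* (a) For all integers $n \geq 1$, $n/2 \leq p_{3,4}(-f_{3,1}(n)) \leq (3n-1)/2$. The lower bound is attained precisely when $(n)_4 \in \{0,1\}^*0$, and the upper bound is attained precisely when $(n)_4 \in \{1\} \cup 2^*3$. (b) For all integers $n \geq 1$, $(n/2)^{\frac{\log 3}{\log 4}} \leq -f_{3,1}(n) \leq \big((9n-3)/4\big)^{\frac{\log 3}{\log 4}}$.
   Context: Let $t(n)$ be the number of $1$'s in the base-$2$ representation of $n$, taken modulo $2$. Define $f_{3,1}(n) = \sum_{0 \leq i < n} (-1)^{t(3i+1)}$ for $n \geq 0$ (these values are nonpositive). For an integer $c \geq 2$, $(n)_c$ is the base-$c$ representation of $n\ge 0$ (most significant digit first, no leading zeros), and for a digit word $x = a_1\cdots a_t$, $[x]_c = \sum_{i=1}^t a_i c^{t-i}$. Define $p_{3,4}(m) = [(m)_3]_4$ for $m \geq 0$. In regular expressions $^*$ is Kleene star and juxtaposition is concatenation. *)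

theory Defs
  imports Complex_Main
begin

(* Most significant digit first; 0 is represented by the empty word.
   The value for c < 2 is a dummy. *)
function base_rep :: "nat \<Rightarrow> nat \<Rightarrow> nat list" where
  "base_rep c n = (if c < 2 \<or> n = 0 then [] else base_rep c (n div c) @ [n mod c])"
  by pat_completeness auto
termination
  by (relation "measure snd") auto

declare base_rep.simps [simp del]

(* The digits are indexed from 0 here, so digit i carries weight
   c ^ (length x - 1 - i). The digits of x need not be smaller than c. *)
definition word_val :: "nat \<Rightarrow> nat list \<Rightarrow> nat" where
  "word_val c x = (\<Sum>i<length x. x ! i * c ^ (length x - 1 - i))"

definition thue_morse :: "nat \<Rightarrow> nat" where
  "thue_morse n = count_list (base_rep 2 n) 1 mod 2"

definition f31 :: "nat \<Rightarrow> int" where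
  "f31 n = (\<Sum>i<n. (-1) ^ thue_morse (3 * i + 1))"

definition p34 :: "nat \<Rightarrow> nat" where
  "p34 m = word_val 4 (base_rep 3 m)"

definition lang_conc :: "'a list set \<Rightarrow> 'a list set \<Rightarrow> 'a list set" where
  "lang_conc A B = {u @ v | u v. u \<in> A \<and> v \<in> B}"

inductive_set lang_star :: "'a list set \<Rightarrow> 'a list set" for A :: "'a list set" where
  empty: "[] \<in> lang_star A"
| append: "u \<in> A \<Longrightarrow> v \<in> lang_star A \<Longrightarrow> u @ v \<in> lang_star A"

end

theory Submission
  imports Defs
begin

text \<open>Splitting \<open>n = 4 * k + r\<close> expresses \<open>- f31 n\<close> through \<open>- f31 k\<close> and two Thue-Morse signs.
  In every case it equals \<open>3 * x + d\<close> with a digit \<open>d < 3\<close> and \<open>x\<close> the value at \<open>k\<close> or one of its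
  neighbours, so that \<open>p34\<close> satisfies a recursion parallel to that of the base 4 digits of \<open>n\<close>;
  the bounds and both equality cases follow together by strong induction. The power bounds
  compare the weights \<open>3 ^ i\<close> and \<open>4 ^ i\<close> through subadditivity and concavity of
  \<open>x powr (ln 3 / ln 4)\<close>, which maps 4 to 3.\<close>

section \<open>Appending a last digit, and the digit recursion of \<open>p34\<close>\<close>

lemma base_rep_step:
  assumes "c \<ge> 2" "d < c" "c * n + d > 0"
  shows "base_rep c (c * n + d) = base_rep c n @ [d]"
  using assms by (subst base_rep.simps) auto

lemma base_rep_0 [simp]: "base_rep c 0 = []"
  by (simp add: base_rep.simps)

lemma word_val_Nil [simp]: "word_val c [] = 0"
  by (simp add: word_val_def)

lemma word_val_snoc: "word_val c (w @ [d]) = c * word_val c w + d"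
proof -
  have "(\<Sum>i<length w. (w @ [d]) ! i * c ^ (length w - i))
      = (\<Sum>i<length w. c * (w ! i * c ^ (length w - 1 - i)))"
  proof (rule sum.cong)
    fix i assume "i \<in> {..<length w}"
    then have "i < length w" by simp
    then have "length w - i = Suc (length w - 1 - i)" by simp
    then have "c ^ (length w - i) = c * c ^ (length w - 1 - i)" by (metis power_Suc)
    then show "(w @ [d]) ! i * c ^ (length w - i) = c * (w ! i * c ^ (length w - 1 - i))"
      using \<open>i < length w\<close> by (simp add: nth_append)
  qed simp
  then show ?thesis
    by (simp add: word_val_def sum_distrib_left)
qed

lemma p34_0 [simp]: "p34 0 = 0"
  by (simp add: p34_def)

lemma p34_step: "d < 3 \<Longrightarrow> p34 (3 * m + d) = 4 * p34 m + d"
  by (cases "3 * m + d = 0") (simp_all add: p34_def base_rep_step word_val_snoc)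

text \<open>Only a carry needs induction. If the last ternary digit is 2, then passing to
  \<open>3 * (q + 1)\<close> adds at least 4 from the higher digits and loses only 2.\<close>

lemma p34_strict_mono_Suc: "p34 m < p34 (Suc m)"
proof (induction m rule: less_induct)
  case (less m)
  define q where "q = m div 3"
  consider "m = 3 * q + 0" | "m = 3 * q + 1" | "m = 3 * q + 2"
    unfolding q_def by linarith
  then show ?case
  proof cases
    case 1
    then show ?thesis using p34_step[of 0 q] p34_step[of 1 q] by simp
  next
    case 2
    then show ?thesis using p34_step[of 1 q] p34_step[of 2 q] by simp
  next
    case 3
    then have "q < m" "Suc m = 3 * Suc q + 0" by simp_all
    then show ?thesis
      using less.IH[of q] 3 p34_step[of 2 q] p34_step[of 0 "Suc q"] by (simp del: mult_Suc_right)
  qed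
qed

section \<open>Thue-Morse signs\<close>

abbreviation tm_sign :: "nat \<Rightarrow> int" where
  "tm_sign n \<equiv> (-1) ^ thue_morse n"

lemma tm_sign_double: "tm_sign (2 * n) = tm_sign n"
  using base_rep_step[of 2 0 n] by (cases "n = 0") (simp_all add: thue_morse_def)

lemma tm_sign_double_Suc: "tm_sign (2 * n + 1) = - tm_sign n"
  using base_rep_step[of 2 1 n]
  by (cases "even (count_list (base_rep 2 n) 1)") (simp_all add: thue_morse_def parity_cases)

lemma tm_sign_cases: "tm_sign n = 1 \<or> tm_sign n = -1"
  by (cases "even (thue_morse n)") simp_all

text \<open>Adding 1 to an even number flips its last binary digit without a carry. The successor is
  a separate variable \<open>m\<close> so that terms such as \<open>3 * k + 3\<close> can be
  matched.\<close>

lemma tm_sign_succ_even: "even n \<Longrightarrow> m = n + 1 \<Longrightarrow> tm_sign m = - tm_sign n"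
  by (elim evenE) (simp only: tm_sign_double tm_sign_double_Suc)

lemma tm_sign_quad:
  "tm_sign (4 * n) = tm_sign n" "tm_sign (4 * n + 1) = - tm_sign n"
  "tm_sign (4 * n + 2) = - tm_sign n" "tm_sign (4 * n + 3) = tm_sign n"
  using tm_sign_double[of "2 * n"] tm_sign_double_Suc[of "2 * n"]
    tm_sign_double[of "2 * n + 1"] tm_sign_double_Suc[of "2 * n + 1"]
    tm_sign_double[of n] tm_sign_double_Suc[of n]
  by (simp_all add: algebra_simps eval_nat_numeral)

text \<open>The arguments are \<open>4 * (3 * k) + 1\<close>, \<open>4 * (3 * k + 1)\<close>,
  \<open>4 * (3 * k + 1) + 3\<close> and \<open>4 * (3 * k + 2) + 2\<close>, so the sign depends on
  one base 4 digit appended to \<open>3 * k\<close>, \<open>3 * k + 1\<close> or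
  \<open>3 * k + 2\<close>.\<close>

lemma tm_sign_triple_quad:
  "tm_sign (3 * (4 * k) + 1) = - tm_sign (3 * k)"
  "tm_sign (3 * (4 * k + 1) + 1) = tm_sign (3 * k + 1)"
  "tm_sign (3 * (4 * k + 2) + 1) = tm_sign (3 * k + 1)"
  "tm_sign (3 * (4 * k + 3) + 1) = - tm_sign (3 * k + 2)"
  using tm_sign_quad[of "3 * k"] tm_sign_quad[of "3 * k + 1"] tm_sign_quad[of "3 * k + 2"]
  by (simp_all add: algebra_simps)

section \<open>Recursion of the sign sums along base 4 digits\<close>

abbreviation neg_f31 :: "nat \<Rightarrow> int" where
  "neg_f31 n \<equiv> - f31 n"

lemma neg_f31_Suc: "neg_f31 (n + 1) = neg_f31 n - tm_sign (3 * n + 1)"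
  by (simp add: f31_def)

lemma neg_f31_0 [simp]: "neg_f31 0 = 0"
  by (simp add: f31_def)

lemma neg_f31_quad:
  "neg_f31 (4 * k + 1) = neg_f31 (4 * k) + tm_sign (3 * k)"
  "neg_f31 (4 * k + 2) = neg_f31 (4 * k) + tm_sign (3 * k) - tm_sign (3 * k + 1)"
  "neg_f31 (4 * k + 3) = neg_f31 (4 * k) + tm_sign (3 * k) - 2 * tm_sign (3 * k + 1)"
  "neg_f31 (4 * k + 4) = neg_f31 (4 * k) + tm_sign (3 * k) - 2 * tm_sign (3 * k + 1) + tm_sign (3 * k + 2)"
  using neg_f31_Suc[of "4 * k"] neg_f31_Suc[of "4 * k + 1"] neg_f31_Suc[of "4 * k + 2"]
    neg_f31_Suc[of "4 * k + 3"] tm_sign_triple_quad[of k]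
  by (simp_all add: eval_nat_numeral)

text \<open>From \<open>4 * k\<close> to \<open>4 * k + 4\<close> the sum gains \<open>tm_sign (3 *
  k) - 2 * tm_sign (3 * k + 1) + tm_sign (3 * k + 2)\<close>, to be compared with
  \<open>- 3 * tm_sign (3 * k + 1)\<close>. For even \<open>k\<close> the first two terms give
  exactly this and the third is the new correction; for odd \<open>k\<close> the first term cancels
  the old correction and the other two give exactly this.\<close>

lemma neg_f31_mult_4:
  "neg_f31 (4 * k) = 3 * neg_f31 k - (if odd k then tm_sign (3 * k) else 0)"
proof (induction k)
  case 0
  show ?case by simp
next
  case (Suc k)
  have "neg_f31 (4 * k + 4) = 3 * neg_f31 (k + 1) - (if odd (k + 1) then tm_sign (3 * k + 3) else 0)"
  proof (cases "even k")
    case True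
    then have "tm_sign (3 * k + 1) = - tm_sign (3 * k)" "tm_sign (3 * k + 3) = - tm_sign (3 * k + 2)"
      by (simp_all add: tm_sign_succ_even)
    then show ?thesis
      using Suc True neg_f31_quad(4)[of k] neg_f31_Suc[of k] by simp
  next
    case False
    then have "tm_sign (3 * k + 2) = - tm_sign (3 * k + 1)"
      by (simp add: tm_sign_succ_even)
    then show ?thesis
      using Suc False neg_f31_quad(4)[of k] neg_f31_Suc[of k] by simp
  qed
  then show ?case by (simp add: add.commute)
qed

text \<open>Here and in the next lemma the correction term of \<open>neg_f31_mult_4\<close> for odd
  \<open>k\<close> is recognised as a step from \<open>k\<close> to its even neighbour not divisible
  by 4 with remainder 2, so that \<open>3 * x - 1\<close> or \<open>3 * x + 1\<close> can be bounded
  through that neighbour.\<close>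

lemma neg_f31_pred_mod_4_eq_1:
  assumes "k mod 4 = 1"
  shows "neg_f31 k = neg_f31 (k - 1) + tm_sign (3 * k)"
proof -
  obtain j where "k = 4 * j + 1" using assms by (metis mult_div_mod_eq)
  then show ?thesis
    using neg_f31_quad(1)[of j] tm_sign_quad(4)[of "3 * j"] by (simp add: algebra_simps)
qed

lemma neg_f31_succ_mod_4_eq_3:
  assumes "k mod 4 = 3"
  shows "neg_f31 (k + 1) = neg_f31 k - tm_sign (3 * k)"
proof -
  obtain j where k: "k = 4 * j + 3" using assms by (metis mult_div_mod_eq)
  have "tm_sign (3 * k) = tm_sign (3 * k + 1)"
    using tm_sign_quad(2,3)[of "3 * j + 2"] by (simp add: k algebra_simps)
  then show ?thesis using neg_f31_Suc[of k] by simp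
qed

section \<open>Extension of \<open>p34\<close> to the integers\<close>

text \<open>Integer arguments avoid truncated subtraction in \<open>x - 1\<close> and
  \<open>3 * x - r\<close>. Negative arguments get the value 0.\<close>

definition p34i :: "int \<Rightarrow> int" where
  "p34i x = int (p34 (nat x))"

lemma p34i_step:
  assumes "x \<ge> 0"
  shows "p34i (3 * x) = 4 * p34i x" "p34i (3 * x + 1) = 4 * p34i x + 1"
    "p34i (3 * x + 2) = 4 * p34i x + 2"
  using assms p34_step[of 0 "nat x"] p34_step[of 1 "nat x"] p34_step[of 2 "nat x"]
  by (simp_all add: p34i_def nat_add_distrib nat_mult_distrib)

lemma p34i_pred:
  assumes "x > 0"
  shows "p34i (x - 1) + 1 \<le> p34i x"
proof -
  have "nat x = Suc (nat (x - 1))" using assms by simp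
  then show ?thesis using p34_strict_mono_Suc[of "nat (x - 1)"] by (simp add: p34i_def)
qed

text \<open>Through this lemma the lower bound on \<open>p34i (neg_f31 n)\<close> also yields that
  \<open>neg_f31 n\<close> is positive for \<open>n > 0\<close>.\<close>

lemma p34i_pos: "p34i x > 0 \<Longrightarrow> x > 0"
  by (cases "x > 0") (auto simp: p34i_def)

lemma p34i_0 [simp]: "p34i 0 = 0"
  by (simp add: p34i_def)

section \<open>Digit patterns of the equality cases, and the bounds on \<open>p34\<close>\<close>

definition lower_digits :: "nat \<Rightarrow> bool" where
  "lower_digits n \<longleftrightarrow> 4 dvd n \<and> set (base_rep 4 n) \<subseteq> {0, 1}"

definition upper_digits :: "nat \<Rightarrow> bool" where
  "upper_digits n \<longleftrightarrow> n = 1 \<or> n mod 4 = 3 \<and> set (base_rep 4 (n div 4)) \<subseteq> {2}"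

lemma set_base_rep_4:
  assumes "r < 4" "4 * k + r > 0"
  shows "set (base_rep 4 (4 * k + r)) = insert r (set (base_rep 4 k))"
  using assms by (simp add: base_rep_step)

lemma base_4_cases:
  obtains k r :: nat where "n = 4 * k + r" "r < 4"
  using mult_div_mod_eq[of 4 n] mod_less_divisor[of 4 n] by (metis zero_less_numeral)

text \<open>An even \<open>k\<close> with such digits ends in 0; an odd one ends in 1, and
  \<open>k - 1\<close> has this 1 replaced by 0. The condition on a prefix thus becomes one at
  \<open>k\<close> or \<open>k - 1\<close>, where an induction hypothesis is available.\<close>

lemma zero_one_digits_iff:
  "set (base_rep 4 k) \<subseteq> {0, 1} \<longleftrightarrow>
     (if even k then lower_digits k else k mod 4 = 1 \<and> lower_digits (k - 1))"
proof -
  obtain j r where k: "k = 4 * j + r" "r < 4" by (rule base_4_cases)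
  consider "r = 0" | "r = 1" | "r = 2" | "r = 3" using k(2) by linarith
  then show ?thesis
  proof cases
    case 2
    then show ?thesis
      using set_base_rep_4[of 1 j] set_base_rep_4[of 0 j]
      by (cases "j = 0") (auto simp: k lower_digits_def)
  next
    case 4
    then show ?thesis
      using set_base_rep_4[of r j] by (simp add: k)
  qed (use k set_base_rep_4[of r j] in \<open>auto simp: lower_digits_def\<close>)
qed

text \<open>Adding 1 turns the last 2 of such a word into 3, and the empty word into the exceptional
  word 1.\<close>

lemma two_digits_iff: "set (base_rep 4 k) \<subseteq> {2} \<longleftrightarrow> upper_digits (k + 1)"
proof -
  obtain j r where k: "k = 4 * j + r" "r < 4" by (rule base_4_cases)
  consider "k = 0" | "k > 0" "r = 0" | "r = 1" | "r = 2" | "r = 3" using k by linarith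
  moreover have "(k + 1) mod 4 = 3 \<longleftrightarrow> r = 2" "r = 2 \<Longrightarrow> (k + 1) div 4 = j"
    using k by presburger+
  ultimately show ?thesis
    by cases (use k set_base_rep_4[of r j] in \<open>auto simp: upper_digits_def\<close>)
qed

lemma lower_digits_quad:
  assumes "r < 4" "k > 0"
  shows "lower_digits (4 * k + r) \<longleftrightarrow>
    r = 0 \<and> (if even k then lower_digits k else k mod 4 = 1 \<and> lower_digits (k - 1))"
proof -
  have "4 dvd 4 * k + r \<longleftrightarrow> r = 0" using assms(1) by presburger
  then show ?thesis
    unfolding zero_one_digits_iff[symmetric] lower_digits_def[of "4 * k + r"]
    using assms set_base_rep_4[of r k] by auto
qed

lemma upper_digits_quad:
  assumes "r < 4" "k > 0"
  shows "upper_digits (4 * k + r) \<longleftrightarrow> r = 3 \<and> upper_digits (k + 1)"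
proof -
  have "4 * k + r \<noteq> 1" "(4 * k + r) mod 4 = r" "(4 * k + r) div 4 = k"
    using assms by simp_all
  then show ?thesis
    unfolding two_digits_iff[symmetric] upper_digits_def[of "4 * k + r"] by simp
qed

lemma lang_star_singletons:
  "w \<in> lang_star ((\<lambda>d. [d]) ` D) \<longleftrightarrow> set w \<subseteq> D"
proof
  show "w \<in> lang_star ((\<lambda>d. [d]) ` D) \<Longrightarrow> set w \<subseteq> D"
    by (induction rule: lang_star.induct) auto
  show "set w \<subseteq> D \<Longrightarrow> w \<in> lang_star ((\<lambda>d. [d]) ` D)"
  proof (induction w)
    case (Cons d w)
    then show ?case using lang_star.append[of "[d]" "(\<lambda>d. [d]) ` D" w] by simp
  qed (rule lang_star.empty)
qed

text \<open>The number 0 satisfies \<open>lower_digits\<close> but its empty word is not in the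
  language, hence the hypothesis.\<close>

lemma lower_digits_iff_lang:
  assumes "n > 0"
  shows "lower_digits n \<longleftrightarrow> base_rep 4 n \<in> lang_conc (lang_star {[0], [1]}) {[0]}"
proof -
  obtain k r where n: "n = 4 * k + r" "r < 4" by (rule base_4_cases)
  have "base_rep 4 n = base_rep 4 k @ [r]" using n assms by (simp add: base_rep_step)
  moreover have "4 dvd n \<longleftrightarrow> r = 0" using n by presburger
  ultimately show ?thesis
    using lang_star_singletons[of _ "{0, 1}"]
    by (auto simp: lower_digits_def lang_conc_def simp del: One_nat_def)
qed

lemma upper_digits_iff_lang:
  assumes "n > 0"
  shows "upper_digits n \<longleftrightarrow> base_rep 4 n \<in> {[1]} \<union> lang_conc (lang_star {[2]}) {[3]}"
proof -
  obtain k r where n: "n = 4 * k + r" "r < 4" by (rule base_4_cases)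
  have rep: "base_rep 4 n = base_rep 4 k @ [r]" using n assms by (simp add: base_rep_step)
  have nil: "base_rep 4 k = [] \<longleftrightarrow> k = 0" by (simp add: base_rep.simps)
  have "n = 1 \<longleftrightarrow> k = 0 \<and> r = 1" "n mod 4 = r" "n div 4 = k" using n by presburger+
  then show ?thesis
    using lang_star_singletons[of _ "{2}"] rep nil by (auto simp: upper_digits_def lang_conc_def)
qed

text \<open>The bounds at \<open>4 * k + r\<close> draw on both bounds at \<open>k\<close> and at
  its neighbours, and strictness of one is read off from the other values, so all claims share one
  induction. The lower claim includes 0, which occurs as \<open>k - 1\<close>; the upper one fails
  there.\<close>

lemma p34i_neg_f31_bounds:
  shows "int n \<le> 2 * p34i (neg_f31 n) \<and> (2 * p34i (neg_f31 n) = n \<longleftrightarrow> lower_digits n)"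
    and "n > 0 \<Longrightarrow> 2 * p34i (neg_f31 n) \<le> 3 * int n - 1 \<and>
      (2 * p34i (neg_f31 n) = 3 * int n - 1 \<longleftrightarrow> upper_digits n)"
proof (induction n rule: less_induct)
  case (less n)
  let ?low = "\<lambda>n. int n \<le> 2 * p34i (neg_f31 n) \<and> (2 * p34i (neg_f31 n) = n \<longleftrightarrow> lower_digits n)"
  let ?upp = "\<lambda>n. 2 * p34i (neg_f31 n) \<le> 3 * int n - 1 \<and>
      (2 * p34i (neg_f31 n) = 3 * int n - 1 \<longleftrightarrow> upper_digits n)"
  obtain k r where n: "n = 4 * k + r" "r < 4" by (rule base_4_cases)
  have "?low n \<and> (n > 0 \<longrightarrow> ?upp n)"
  proof (cases "k = 0")
    case True
    have "tm_sign 0 = 1" "tm_sign 1 = -1"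
      using tm_sign_double_Suc[of 0] by (simp_all add: thue_morse_def)
    then have a: "neg_f31 1 = 1" "neg_f31 2 = 2" "neg_f31 3 = 3"
      using neg_f31_quad(1-3)[of 0] by (simp_all add: numeral_2_eq_2)
    have p: "p34i 1 = 1" "p34i 2 = 2" "p34i 3 = 4"
      using p34i_step[of 0] p34i_step(1)[of 1] by simp_all
    consider "n = 0" | "n = 1" | "n = 2" | "n = 3" using n True by linarith
    then show ?thesis
      by cases (use a p in \<open>auto simp: lower_digits_def upper_digits_def\<close>)
  next
    case False
    define x where "x = neg_f31 k"
    have "k < n" "k + 1 < n" "k - 1 < n" using n False by simp_all
    with less.IH[of k] less.IH[of "k + 1"] less.IH(1)[of "k - 1"] False
    have IH: "?low k" "?upp k" "?low (k + 1)" "?upp (k + 1)" "?low (k - 1)" by simp_all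
    have "x > 0" using IH(1) False p34i_pos[of x] by (simp add: x_def)
    have pred: "p34i (x - 1) + 1 \<le> p34i x" by (rule p34i_pred) fact
    have succ: "p34i x + 1 \<le> p34i (x + 1)" using p34i_pred[of "x + 1"] \<open>x > 0\<close> by simp
    \<comment> \<open>Every value of \<open>neg_f31 n\<close> that occurs below is
      \<open>3 * x + e\<close> with \<open>e\<close> between -3 and 3; negative \<open>e\<close>
      borrows from \<open>x - 1\<close>.\<close>
    have step: "p34i (3 * x) = 4 * p34i x" "p34i (3 * x + 1) = 4 * p34i x + 1"
      "p34i (3 * x + 2) = 4 * p34i x + 2" "p34i (3 * x + 3) = 4 * p34i (x + 1)"
      "p34i (3 * x - 1) = 4 * p34i (x - 1) + 2" "p34i (3 * x - 2) = 4 * p34i (x - 1) + 1"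
      "p34i (3 * x - 3) = 4 * p34i (x - 1)"
      using p34i_step[of x] p34i_step[of "x - 1"] p34i_step(1)[of "x + 1"] \<open>x > 0\<close>
      by (simp_all add: algebra_simps)
    have nxt: "neg_f31 (k + 1) = x - tm_sign (3 * k + 1)"
      unfolding x_def by (rule neg_f31_Suc)
    have r: "r = 0 \<or> r = 1 \<or> r = 2 \<or> r = 3" using n(2) by linarith
    have low: "lower_digits n \<longleftrightarrow> r = 0 \<and>
        (if even k then lower_digits k else k mod 4 = 1 \<and> lower_digits (k - 1))"
      and upp: "upper_digits n \<longleftrightarrow> r = 3 \<and> upper_digits (k + 1)"
      unfolding n(1) using n(2) False by (simp_all add: lower_digits_quad upper_digits_quad)
    show ?thesis
    proof (cases "even k")
      case True
      have sgn: "tm_sign (3 * k + 1) = - tm_sign (3 * k)"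
        using True by (intro tm_sign_succ_even) simp_all
      \<comment> \<open>For even \<open>k\<close> the correction vanishes and the opposite signs at
        \<open>3 * k\<close> and \<open>3 * k + 1\<close> make all steps go in one
        direction.\<close>
      have a: "neg_f31 n = 3 * x + int r * tm_sign (3 * k)"
        using r n(1) sgn True neg_f31_mult_4[of k] neg_f31_quad[of k] by (auto simp: x_def)
      \<comment> \<open>The induction hypotheses turn both digit conditions into equations between
        \<open>p34i\<close> values, which leaves linear arithmetic.\<close>
      have low': "lower_digits n \<longleftrightarrow> r = 0 \<and> 2 * p34i x = int k"
        using low True IH(1) by (simp add: x_def)
      have upp': "upper_digits n \<longleftrightarrow> r = 3 \<and> 2 * p34i (neg_f31 (k + 1)) = 3 * int k + 2"
        using upp IH(4) by (simp add: add.commute)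
      have bds: "int k \<le> 2 * p34i x" "2 * p34i x \<le> 3 * int k - 1"
        "int k + 1 \<le> 2 * p34i (neg_f31 (k + 1))" "2 * p34i (neg_f31 (k + 1)) \<le> 3 * int k + 2"
        using IH by (simp_all add: x_def)
      show ?thesis
      proof (cases "tm_sign (3 * k) = 1")
        case pos: True
        then have "neg_f31 n = 3 * x + int r" "neg_f31 (k + 1) = x + 1"
          using a sgn nxt by simp_all
        then show ?thesis
          using r bds step unfolding low' upp' by (elim disjE) (auto simp: n(1))
      next
        case neg: False
        then have "neg_f31 n = 3 * x - int r" "neg_f31 (k + 1) = x - 1"
          using a sgn nxt tm_sign_cases[of "3 * k"] by simp_all
        then show ?thesis
          using r bds step pred unfolding low' upp' by (elim disjE) (auto simp: n(1))
      qed
    next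
      case odd: False
      \<comment> \<open>Parity improves the lower bound at an odd \<open>k\<close> by 1.\<close>
      have ge: "int k + 1 \<le> 2 * p34i x"
      proof -
        have "int k \<noteq> 2 * p34i x" using odd by (metis dvd_triv_left even_of_nat_iff)
        then show ?thesis using IH(1) unfolding x_def by linarith
      qed
      have "int (k - 1) = int k - 1" using False by simp
      have a0: "neg_f31 (4 * k) = 3 * x - tm_sign (3 * k)"
        using odd neg_f31_mult_4[of k] by (simp add: x_def)
      have "(k + 1) mod 4 \<noteq> 3" using odd by presburger
      then have not_upp: "\<not> upper_digits n"
        using upp False by (simp add: upper_digits_def)
      show ?thesis
      proof (cases "r = 0")
        case True
        then have n: "n = 4 * k" using n by simp
        have "k mod 4 = 1 \<or> k mod 4 = 3" using odd by presburger
        then consider "k mod 4 = 1" | "k mod 4 = 3" by blast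
        then show ?thesis
        proof cases
          case 1
          then have nb: "x = neg_f31 (k - 1) + tm_sign (3 * k)"
            unfolding x_def by (rule neg_f31_pred_mod_4_eq_1)
          have low: "lower_digits n \<longleftrightarrow> lower_digits (k - 1)"
            using low True odd 1 by simp
          show ?thesis
          proof (cases "tm_sign (3 * k) = 1")
            case True
            \<comment> \<open>Since \<open>3 * x - 1 = 3 * (x - 1) + 2\<close>, the doubled value is
              4 times that at \<open>k - 1\<close> plus 4, so equality in the lower bound passes
              between \<open>k - 1\<close> and \<open>n = 4 * (k - 1) + 4\<close>.\<close>
            then have "neg_f31 n = 3 * x - 1" "neg_f31 (k - 1) = x - 1"
              using a0 nb n by simp_all
            then show ?thesis
              using IH(2,5) step(5) low pred not_upp n \<open>int (k - 1) = int k - 1\<close>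
              by (auto simp: x_def)
          next
            case False
            \<comment> \<open>Equality fails at \<open>n\<close> by \<open>ge\<close>, and also at
              \<open>k - 1\<close>, because \<open>succ\<close> and \<open>ge\<close> push the value
              at \<open>x + 1\<close> too high.\<close>
            then have "neg_f31 n = 3 * x + 1" "neg_f31 (k - 1) = x + 1"
              using a0 nb n tm_sign_cases[of "3 * k"] by simp_all
            then show ?thesis
              using IH(2,5) step(2) low succ ge not_upp n \<open>int (k - 1) = int k - 1\<close>
              by (auto simp: x_def)
          qed
        next
          case 2
          then have nb: "neg_f31 (k + 1) = x - tm_sign (3 * k)"
            unfolding x_def by (rule neg_f31_succ_mod_4_eq_3)
          have low: "\<not> lower_digits n" using low odd 2 by simp
          show ?thesis
          proof (cases "tm_sign (3 * k) = 1")
            case True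
            then have "neg_f31 n = 3 * x - 1" "neg_f31 (k + 1) = x - 1"
              using a0 nb n by simp_all
            then show ?thesis
              using IH(2,3) step(5) low pred not_upp n by (auto simp: x_def)
          next
            case False
            then have "neg_f31 n = 3 * x + 1"
              using a0 n tm_sign_cases[of "3 * k"] by simp_all
            then show ?thesis
              using IH(2) step(2) low ge not_upp n by (auto simp: x_def)
          qed
        qed
      next
        case False
        define b where "b = tm_sign (3 * k + 1)"
        \<comment> \<open>The first step, to \<open>4 * k + 1\<close>, cancels the correction term;
          each later step subtracts \<open>b\<close>.\<close>
        have a: "neg_f31 n = 3 * x - (int r - 1) * b"
          using False r a0 neg_f31_quad[of k] n(1) by (auto simp: b_def)
        have not_low: "\<not> lower_digits n" using low False by simp
        have "2 * p34i x \<le> 3 * int k - 1" using IH(2) by (simp add: x_def)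
        moreover have "b = 1 \<or> b = -1" unfolding b_def by (rule tm_sign_cases)
        moreover have "int k + 1 \<le> 2 * p34i (x - b)" using IH(3) nxt by (simp add: b_def)
        moreover have "r = 1 \<or> r = 2 \<or> r = 3" using r False by simp
        ultimately show ?thesis
          using step pred ge a not_low not_upp by (elim disjE) (simp_all add: n(1))
      qed
    qed
  qed
  then show "?low n" "n > 0 \<Longrightarrow> ?upp n" by simp_all
qed

section \<open>Concavity and subadditivity of powers, and the power bounds for
  \<open>p34\<close>\<close>

lemma powr_diff_antimono:
  fixes s t h l :: real
  assumes "0 < s" "s \<le> t" "0 \<le> h" "0 \<le> l" "l \<le> 1"
  shows "(t + h) powr l - t powr l \<le> (s + h) powr l - s powr l"
proof (rule DERIV_nonpos_imp_nonincreasing[OF \<open>s \<le> t\<close>])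
  fix x assume x: "s \<le> x" "x \<le> t"
  have "((\<lambda>x. (x + h) powr l - x powr l) has_real_derivative
      l * (x + h) powr (l - 1) - l * x powr (l - 1)) (at x)"
    using x assms by (auto intro!: derivative_eq_intros)
  \<comment> \<open>The exponent \<open>l - 1\<close> is not positive, so the power is
    antitone.\<close>
  moreover have "(x + h) powr (l - 1) \<le> x powr (l - 1)"
    using x assms by (intro powr_mono2') simp_all
  then have "l * (x + h) powr (l - 1) - l * x powr (l - 1) \<le> 0"
    using assms by (simp add: mult_left_mono)
  ultimately show "\<exists>y. ((\<lambda>x. (x + h) powr l - x powr l) has_real_derivative y) (at x) \<and> y \<le> 0"
    by blast
qed

text \<open>On the unit interval \<open>z \<le> z powr l\<close>; this is applied to the shares of
  \<open>x\<close> and \<open>y\<close> in \<open>x + y\<close>, which sum to 1.\<close>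

lemma powr_subadditive:
  fixes x y l :: real
  assumes "0 \<le> x" "0 \<le> y" "l \<le> 1"
  shows "(x + y) powr l \<le> x powr l + y powr l"
proof (cases "x + y = 0")
  case False
  then have pos: "x + y > 0" using assms by simp
  have "z \<le> z powr l" if "0 \<le> z" "z \<le> 1" for z :: real
    using powr_mono'[of l 1 z] that assms by (cases "z = 0") simp_all
  from this[of "x / (x + y)"] this[of "y / (x + y)"]
  have "x / (x + y) + y / (x + y) \<le> (x powr l + y powr l) / (x + y) powr l"
    using pos assms by (simp add: powr_divide add_divide_distrib)
  then have "1 \<le> (x powr l + y powr l) / (x + y) powr l"
    using pos by (simp flip: add_divide_distrib)
  then show ?thesis using pos by (simp add: divide_simps)
qed (use assms in simp)

abbreviation log43 :: real where
  "log43 \<equiv> ln 3 / ln 4"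

lemma log43_bounds: "0 < log43" "log43 \<le> 1"
  by simp_all

lemma four_powr_log43: "4 powr log43 = 3"
  by (simp add: powr_def)

lemma four_mult_powr_log43: "0 \<le> x \<Longrightarrow> (4 * x) powr log43 = 3 * x powr log43"
  by (simp add: powr_mult four_powr_log43)

text \<open>Subadditivity splits off the last digit, the factor 4 becomes 3, and a digit that is 0
  or at least 1 dominates its power.\<close>

lemma p34_powr_le: "real (p34 m) powr log43 \<le> real m"
proof (induction m rule: less_induct)
  case (less m)
  show ?case
  proof (cases "m = 0")
    case False
    define q d where "q = m div 3" and "d = m mod 3"
    have m: "m = 3 * q + d" "d < 3" "q < m" using False by (simp_all add: q_def d_def)
    have d: "real d powr log43 \<le> real d"
      using powr_mono[of log43 1 "real d"] log43_bounds by (cases "d = 0") simp_all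
    have "real (p34 m) powr log43 = (4 * real (p34 q) + real d) powr log43"
      using m by (simp add: p34_step)
    also have "\<dots> \<le> (4 * real (p34 q)) powr log43 + real d powr log43"
      using log43_bounds by (intro powr_subadditive) simp_all
    also have "\<dots> = 3 * real (p34 q) powr log43 + real d powr log43"
      by (simp add: four_mult_powr_log43)
    also have "\<dots> \<le> 3 * real q + real d"
      using less.IH[OF m(3)] d by (intro add_mono mult_left_mono) simp_all
    also have "\<dots> = real m" using m by simp
    finally show ?thesis .
  qed simp
qed

text \<open>The shift by 1 on both sides makes the bound sharp at \<open>m = 3 ^ k - 1\<close>, where all
  ternary digits are 2, and thereby inductive.\<close>

lemma le_p34_powr: "real m + 1 \<le> (3 / 2 * real (p34 m) + 1) powr log43"
proof (induction m rule: less_induct)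
  case (less m)
  show ?case
  proof (cases "m = 0")
    case False
    define q d where "q = m div 3" and "d = m mod 3"
    have m: "m = 3 * q + d" "d < 3" "q < m" using False by (simp_all add: q_def d_def)
    \<comment> \<open>The right-hand base is \<open>4 * y + 1\<close>, \<open>4 * y + 5 / 2\<close>
      or \<open>4 * y + 4\<close> for \<open>d\<close> equal to 0, 1 or 2. The case 2 follows
      directly from the induction hypothesis.\<close>
    define y where "y = 3 / 2 * real (p34 q)"
    have "y \<ge> 0" by (simp add: y_def)
    have "(4 * y + 4) powr log43 = (4 * (y + 1)) powr log43" by (simp add: algebra_simps)
    also have "\<dots> = 3 * (y + 1) powr log43"
      using \<open>y \<ge> 0\<close> by (intro four_mult_powr_log43) simp
    also have "\<dots> \<ge> 3 * real q + 3"
      using less.IH[OF m(3)] by (simp add: y_def)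
    finally have p4: "3 * real q + 3 \<le> (4 * y + 4) powr log43" .
    \<comment> \<open>The increment over length 3 is at most the one starting at 1, which is 3 - 1 =
      2; this settles digit 0.\<close>
    have "(4 * y + 1 + 3) powr log43 - (4 * y + 1) powr log43 \<le> (1 + 3) powr log43 - 1 powr log43"
      using \<open>y \<ge> 0\<close> log43_bounds by (intro powr_diff_antimono) simp_all
    then have p1: "3 * real q + 1 \<le> (4 * y + 1) powr log43"
      using p4 by (simp add: four_powr_log43 add.commute)
    \<comment> \<open>Midpoint concavity: \<open>4 * y + 5 / 2\<close> lies halfway between the
      bases for digits 0 and 2.\<close>
    have "(4 * y + 5 / 2 + 3 / 2) powr log43 - (4 * y + 5 / 2) powr log43
        \<le> (4 * y + 1 + 3 / 2) powr log43 - (4 * y + 1) powr log43"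
      using \<open>y \<ge> 0\<close> log43_bounds by (intro powr_diff_antimono) simp_all
    then have p2: "3 * real q + 2 \<le> (4 * y + 5 / 2) powr log43"
      using p1 p4 by (simp add: add.commute)
    have "3 / 2 * real (p34 m) + 1 = 4 * y + (1 + 3 / 2 * real d)"
      using m by (simp add: p34_step y_def)
    moreover have "d = 0 \<or> d = 1 \<or> d = 2" using m by linarith
    moreover have "real m = 3 * real q + real d" using m(1) by simp
    ultimately show ?thesis
      using p1 p2 p4 by (elim disjE) (simp_all only:, simp_all)
  qed simp
qed

theorem theorem8:
  shows "(\<forall>n::nat. n \<ge> 1 \<longrightarrow>
            real n / 2 \<le> real (p34 (nat (- f31 n)))
          \<and> real (p34 (nat (- f31 n))) \<le> (3 * real n - 1) / 2
          \<and> (real (p34 (nat (- f31 n))) = real n / 2 \<longleftrightarrow>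
               base_rep 4 n \<in> lang_conc (lang_star {[0], [1]}) {[0]})
          \<and> (real (p34 (nat (- f31 n))) = (3 * real n - 1) / 2 \<longleftrightarrow>
               base_rep 4 n \<in> {[1]} \<union> lang_conc (lang_star {[2]}) {[3]}))
       \<and> (\<forall>n::nat. n \<ge> 1 \<longrightarrow>
            (real n / 2) powr (ln 3 / ln 4) \<le> real_of_int (- f31 n)
          \<and> real_of_int (- f31 n) \<le> ((9 * real n - 3) / 4) powr (ln 3 / ln 4))"
proof (intro conjI allI impI)
  fix n :: nat
  assume "n \<ge> 1"
  then have n: "n > 0" by simp
  define m where "m = nat (- f31 n)"
  have lower: "n \<le> 2 * p34 m" "2 * p34 m = n \<longleftrightarrow> lower_digits n"
    and upper: "int (2 * p34 m) \<le> 3 * int n - 1"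
      "int (2 * p34 m) = 3 * int n - 1 \<longleftrightarrow> upper_digits n"
    using p34i_neg_f31_bounds[of n] n unfolding m_def p34i_def by linarith+
  have real_upper: "real_of_int (int (2 * p34 m)) \<le> real_of_int (3 * int n - 1)"
    using upper(1) by (simp only: of_int_le_iff)
  show "real n / 2 \<le> real (p34 (nat (- f31 n)))"
    using lower(1) by (simp flip: m_def)
  show "real (p34 (nat (- f31 n))) \<le> (3 * real n - 1) / 2"
    using real_upper by (simp flip: m_def)
  have "real (p34 m) = real n / 2 \<longleftrightarrow> 2 * p34 m = n" by linarith
  then show "real (p34 (nat (- f31 n))) = real n / 2 \<longleftrightarrow>
      base_rep 4 n \<in> lang_conc (lang_star {[0], [1]}) {[0]}"
    using lower(2) lower_digits_iff_lang[OF n] by (simp only: m_def)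
  have "real (p34 m) = (3 * real n - 1) / 2 \<longleftrightarrow>
      real_of_int (int (2 * p34 m)) = real_of_int (3 * int n - 1)" by auto
  then have "real (p34 m) = (3 * real n - 1) / 2 \<longleftrightarrow> int (2 * p34 m) = 3 * int n - 1"
    by (simp only: of_int_eq_iff)
  then show "real (p34 (nat (- f31 n))) = (3 * real n - 1) / 2 \<longleftrightarrow>
      base_rep 4 n \<in> {[1]} \<union> lang_conc (lang_star {[2]}) {[3]}"
    using upper(2) upper_digits_iff_lang[OF n] by (simp only: m_def)
  \<comment> \<open>A positive value rules out that \<open>nat\<close> truncated a negative
    \<open>- f31 n\<close>.\<close>
  have "p34 m > 0" using lower(1) n by simp
  then have m: "real m = real_of_int (- f31 n)"
    using p34i_pos[of "- f31 n"] by (simp add: m_def p34i_def)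
  have "(real n / 2) powr log43 \<le> real (p34 m) powr log43"
    using lower(1) log43_bounds by (intro powr_mono2) simp_all
  also have "\<dots> \<le> real m" by (rule p34_powr_le)
  finally show "(real n / 2) powr log43 \<le> real_of_int (- f31 n)" by (simp only: m)
  have "real m + 1 \<le> (3 / 2 * real (p34 m) + 1) powr log43" by (rule le_p34_powr)
  \<comment> \<open>Subadditivity removes the shift by 1 from both sides; then 3/2 times the upper
    bound \<open>(3 * real n - 1) / 2\<close> is \<open>(9 * real n - 3) / 4\<close>.\<close>
  also have "\<dots> \<le> (3 / 2 * real (p34 m)) powr log43 + 1 powr log43"
    using log43_bounds by (intro powr_subadditive) simp_all
  finally have "real m \<le> (3 / 2 * real (p34 m)) powr log43" by simp
  also have "\<dots> \<le> ((9 * real n - 3) / 4) powr log43"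
    using real_upper log43_bounds by (intro powr_mono2) simp_all
  finally show "real_of_int (- f31 n) \<le> ((9 * real n - 3) / 4) powr log43" by (simp only: m)
qed

end
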